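(* Let $D$ be an integral domain with field of fractions $K$, and let $E\subseteq D$ be a finite non-empty subset. Then the ring of integer-valued polynomials $\operatorname{Int}(E,D)=\{g\in K[X]\mid g(E)\subseteq D\}$ is quasi-coherent if and only if $D$ is quasi-coherent.
   Context: All rings are commutative with identity. A ring $S$ is quasi-coherent if every ideal of the form $(0:_S a)=\{x\in S\mid xa=0\}$ with $a\in S$ is finitely generated, and every intersection of finitely many principal ideals of $S$ is finitely generated. *)

theory Defs
  imports
    "HOL-Algebra.Algebraic_Closure_Type"
    "HOL-Computational_Algebra.Polynomial_Factorial"
begin

definition finitely_generated_ideal :: "'a set \<Rightarrow> ('a, 'm) ring_scheme \<Rightarrow> bool"
  where "finitely_generated_ideal I R \<longleftrightarrow>
    ideal I R \<and> (\<exists>A \<subseteq> carrier R. finite A \<and> I = Idl\<^bsub>R\<^esub> A)"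

text \<open>The intersection of the empty family is the unit ideal, which is always finitely
  generated, so only non-empty families of principal ideals are mentioned.\<close>

locale quasi_coherent_ring = cring +
  assumes annihilator_fg:
    "a \<in> carrier R \<Longrightarrow> finitely_generated_ideal {x \<in> carrier R. x \<otimes> a = \<zero>} R"
  and Inter_principal_fg:
    "\<lbrakk>A \<subseteq> carrier R; finite A; A \<noteq> {}\<rbrakk> \<Longrightarrow> finitely_generated_ideal (\<Inter>a\<in>A. PIdl a) R"

text \<open>The domain \<open>D\<close> is the whole type \<open>'a\<close>, its field of fractions is \<open>'a fract\<close>, and \<open>D\<close>
  sits inside it as \<open>range to_fract\<close>.\<close>

definition int_valued_polys :: "'a::idom set \<Rightarrow> 'a fract poly set"
  where "int_valued_polys E = {g. poly g ` to_fract ` E \<subseteq> range to_fract}"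

definition int_valued_ring :: "'a::idom set \<Rightarrow> 'a fract poly ring"
  where "int_valued_ring E = ring_of_type_algebra\<lparr>carrier := int_valued_polys E\<rparr>"

lemma subring_int_valued_polys:
  "subring (int_valued_polys E) (ring_of_type_algebra :: 'a::idom fract poly ring)"
proof -
  let ?P = "ring_of_type_algebra :: 'a fract poly ring"
  interpret cring ?P by (rule cring_from_type_algebra)
  have inv: "\<ominus>\<^bsub>?P\<^esub> g = - g" for g
    by (rule minus_equality) (auto simp: ring_of_type_algebra_def)
  show ?thesis
  proof (rule subringI)
    show "int_valued_polys E \<subseteq> carrier ?P" "\<one>\<^bsub>?P\<^esub> \<in> int_valued_polys E"
      by (auto simp: ring_of_type_algebra_def int_valued_polys_def
          intro: range_eqI[where x = 1])
  next
    fix g h assume gh: "g \<in> int_valued_polys E" "h \<in> int_valued_polys E"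
    have val: "\<exists>c. poly f (to_fract e) = to_fract c"
      if "f \<in> int_valued_polys E" "e \<in> E" for f e
      using that by (auto simp: int_valued_polys_def)
    show "\<ominus>\<^bsub>?P\<^esub> g \<in> int_valued_polys E"
      unfolding inv int_valued_polys_def using val[OF gh(1)]
      by (fastforce simp flip: to_fract_uminus)
    show "g \<otimes>\<^bsub>?P\<^esub> h \<in> int_valued_polys E" "g \<oplus>\<^bsub>?P\<^esub> h \<in> int_valued_polys E"
      using val[OF gh(1)] val[OF gh(2)]
      by (fastforce simp: int_valued_polys_def ring_of_type_algebra_def
          simp flip: to_fract_mult to_fract_add)+
  qed
qed

lemma cring_int_valued_ring: "cring (int_valued_ring E)"
proof -
  interpret cring "ring_of_type_algebra :: 'a fract poly ring"
    by (rule cring_from_type_algebra)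
  show ?thesis
    unfolding int_valued_ring_def
    by (rule subcring_iff[THEN iffD1, OF _ subcringI'[OF subring_int_valued_polys]])
      (simp add: ring_of_type_algebra_def)
qed

end

theory Submission
  imports Defs
begin

text \<open>Evaluation at a point of \<open>E\<close> retracts \<open>Int(E,D)\<close> onto the constants \<open>D\<close>, and
  quasi-coherence descends to retracts.  Conversely let \<open>L\<close> be a least common multiple in \<open>K[X]\<close>
  of nonzero \<open>f\<^sub>1, \<dots>, f\<^sub>m \<in> Int(E,D)\<close>.  The intersection of the ideals generated by the \<open>f\<^sub>i\<close>
  consists of the \<open>L g\<close> with \<open>g \<in> K[X]\<close> and \<open>g(e) (L/f\<^sub>i)(e) \<in> D\<close> for all \<open>i\<close> and all \<open>e \<in> E\<close>.
  The cofactors \<open>L/f\<^sub>i\<close> have no common root, so for each \<open>e\<close> the admissible values \<open>g(e)\<close> form a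
  fractional ideal \<open>M\<^sub>e\<close> isomorphic to a finite intersection of principal ideals of \<open>D\<close>.  With
  \<open>l\<^sub>e\<close> the Lagrange basis polynomials, generators of the intersection are the \<open>L c l\<^sub>e\<close>, for \<open>c\<close>
  in a finite generating set of \<open>M\<^sub>e\<close>, together with \<open>L d\<close> for one nonzero
  \<open>d \<in> D\<close> lying in every \<open>M\<^sub>e\<close>: a polynomial vanishing on \<open>E\<close> stays in \<open>Int(E,D)\<close>
  after division by \<open>d\<close>.\<close>

section \<open>Finitely generated ideals\<close>

text \<open>Negatives need no separate condition: they arise by multiplying with
  \<open>\<ominus> \<one>\<close>. Ideals are later checked through these closure
  conditions.\<close>

lemma (in cring) ideal_iff:
  "ideal I R \<longleftrightarrow> I \<subseteq> carrier R \<and> \<zero> \<in> I \<and> (\<forall>a\<in>I. \<forall>b\<in>I. a \<oplus> b \<in> I)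
    \<and> (\<forall>a\<in>I. \<forall>r\<in>carrier R. r \<otimes> a \<in> I)"
  (is "_ = ?rhs")
proof
  assume "ideal I R"
  then interpret ideal I R .
  show ?rhs using I_l_closed a_subset by auto
next
  assume rhs: ?rhs
  have neg: "\<ominus> a \<in> I" if "a \<in> I" for a
  proof -
    have "a \<in> carrier R" using rhs that by blast
    then have "(\<ominus> \<one>) \<otimes> a = \<ominus> a" by (simp add: l_minus)
    moreover have "(\<ominus> \<one>) \<otimes> a \<in> I" using rhs that by simp
    ultimately show ?thesis by simp
  qed
  show "ideal I R"
  proof (rule idealI)
    show "ring R" by (rule ring_axioms)
    show "subgroup I (add_monoid R)"
    proof (rule add.subgroupI)
      show "I \<subseteq> carrier R" "I \<noteq> {}" using rhs by auto
      show "\<ominus> a \<in> I" if "a \<in> I" for a using that by (rule neg)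
      show "a \<oplus> b \<in> I" if "a \<in> I" "b \<in> I" for a b
        using rhs that by simp
    qed
    show "r \<otimes> a \<in> I" "a \<otimes> r \<in> I" if "a \<in> I" "r \<in> carrier R" for a r
    proof -
      show "r \<otimes> a \<in> I" using rhs that by simp
      moreover have "a \<in> carrier R" using rhs that by blast
      ultimately show "a \<otimes> r \<in> I" using that m_comm[of a r] by simp
    qed
  qed
qed

text \<open>Generation as a universal property: to show that \<open>A\<close> generates
  \<open>I\<close>, one tests against an arbitrary ideal containing \<open>A\<close>. This avoids
  expressing elements as linear combinations of generators.\<close>

lemma (in cring) finitely_generated_ideal_iff:
  "finitely_generated_ideal I R \<longleftrightarrow> ideal I R \<and>
    (\<exists>A. finite A \<and> A \<subseteq> I \<and> (\<forall>J. ideal J R \<longrightarrow> A \<subseteq> J \<longrightarrow> I \<subseteq> J))"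
proof (intro iffI conjI)
  assume "finitely_generated_ideal I R"
  then obtain A where A: "ideal I R" "A \<subseteq> carrier R" "finite A" "I = Idl A"
    by (auto simp: finitely_generated_ideal_def)
  show "ideal I R" by fact
  show "\<exists>A. finite A \<and> A \<subseteq> I \<and> (\<forall>J. ideal J R \<longrightarrow> A \<subseteq> J \<longrightarrow> I \<subseteq> J)"
    unfolding A(4) using A(3) genideal_self[OF A(2)] genideal_minimal by (intro exI[of _ A]) simp
next
  assume "ideal I R \<and>
    (\<exists>A. finite A \<and> A \<subseteq> I \<and> (\<forall>J. ideal J R \<longrightarrow> A \<subseteq> J \<longrightarrow> I \<subseteq> J))"
  then obtain A where I: "ideal I R"
    and A: "finite A" "A \<subseteq> I" "\<And>J. ideal J R \<Longrightarrow> A \<subseteq> J \<Longrightarrow> I \<subseteq> J"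
    by auto
  from I have "I \<subseteq> carrier R" by (simp add: ideal_iff)
  with A(2) have carr: "A \<subseteq> carrier R" by blast
  have "I = Idl A"
    using A(3)[OF genideal_ideal[OF carr] genideal_self[OF carr]] genideal_minimal[OF I A(2)]
    by (rule subset_antisym)
  with I A(1) carr show "finitely_generated_ideal I R"
    unfolding finitely_generated_ideal_def by auto
qed

lemma (in cring) finitely_generated_zero: "finitely_generated_ideal {\<zero>} R"
  unfolding finitely_generated_ideal_def
  using zeroideal genideal_zero by (intro conjI exI[of _ "{\<zero>}"]) auto

lemma (in cring) finitely_generated_carrier: "finitely_generated_ideal (carrier R) R"
  unfolding finitely_generated_ideal_def
  using oneideal genideal_one by (intro conjI exI[of _ "{\<one>}"]) auto

lemma (in cring) Inter_PIdl_ideal: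
  assumes "A \<subseteq> carrier R" "A \<noteq> {}"
  shows "ideal (\<Inter>a\<in>A. PIdl a) R"
  using assms by (intro i_Intersect) (auto intro: cgenideal_ideal)

section \<open>Retracts\<close>

text \<open>If \<open>A\<close> generates \<open>I\<close>, then \<open>p\<close>
  A\<open>generates\<close>J\<open>. The preimage under\<close>p\<open>of an ideal\<close>N\<open>containing\<close>p
  \<open>A\<close> is an ideal containing \<open>A\<close>, hence \<open>I\<close>; so
  \<open>y = p (i y)\<close> lies in \<open>N\<close> for every \<open>y\<close> in
  \<open>J\<close>.\<close>

lemma finitely_generated_retract:
  assumes R: "cring R" and S: "cring S"
    and hom: "p \<in> ring_hom R S"
    and fg: "finitely_generated_ideal I R" and J: "ideal J S"
    and IJ: "\<And>x. x \<in> I \<Longrightarrow> p x \<in> J" and JI: "\<And>y. y \<in> J \<Longrightarrow> i y \<in> I"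
    and ret: "\<And>y. y \<in> carrier S \<Longrightarrow> p (i y) = y"
  shows "finitely_generated_ideal J S"
proof -
  interpret R: cring R by fact
  interpret S: cring S by fact
  interpret p: ring_hom_ring R S p
    using hom by (intro ring_hom_ringI2) unfold_locales
  obtain A where A: "ideal I R" "finite A" "A \<subseteq> I"
      "\<And>N. ideal N R \<Longrightarrow> A \<subseteq> N \<Longrightarrow> I \<subseteq> N"
    using fg by (auto simp: R.finitely_generated_ideal_iff)
  have "J \<subseteq> N" if N: "ideal N S" "p ` A \<subseteq> N" for N
  proof -
    have "ideal {x \<in> carrier R. p x \<in> N} R"
      using N(1) unfolding R.ideal_iff S.ideal_iff by simp
    then have "I \<subseteq> {x \<in> carrier R. p x \<in> N}"
    proof (rule A(4))
      have "A \<subseteq> carrier R" using A(1,3) unfolding R.ideal_iff by blast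
      then show "A \<subseteq> {x \<in> carrier R. p x \<in> N}" using N(2) by blast
    qed
    then have "p (i y) \<in> N" if "y \<in> J" for y using JI[OF that] by blast
    moreover have "J \<subseteq> carrier S" using J by (simp add: S.ideal_iff)
    ultimately show ?thesis using ret by (metis subset_iff)
  qed
  moreover have "p ` A \<subseteq> J" using A(3) IJ by blast
  ultimately show ?thesis
    unfolding S.finitely_generated_ideal_iff using J A(2) by (blast intro: finite_imageI)
qed

text \<open>The annihilator of \<open>a\<close> corresponds to that of \<open>i a\<close>, and an
  intersection of principal ideals to the one with generators moved by \<open>i\<close>:
  \<open>i\<close> maps from \<open>S\<close> into the ideal of \<open>R\<close>, and
  \<open>p\<close> maps back.\<close>

lemma quasi_coherent_retract:
  assumes qc: "quasi_coherent_ring R" and S: "cring S"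
    and p: "p \<in> ring_hom R S" and i: "i \<in> ring_hom S R"
    and ret: "\<And>y. y \<in> carrier S \<Longrightarrow> p (i y) = y"
  shows "quasi_coherent_ring S"
proof -
  interpret R: quasi_coherent_ring R by fact
  interpret S: cring S by fact
  interpret p: ring_hom_ring R S p
    using p by (intro ring_hom_ringI2) unfold_locales
  interpret i: ring_hom_ring S R i
    using i by (intro ring_hom_ringI2) unfold_locales
  show ?thesis
  proof unfold_locales
    fix a assume a: "a \<in> carrier S"
    have ann: "ideal {x \<in> carrier S. x \<otimes>\<^bsub>S\<^esub> a = \<zero>\<^bsub>S\<^esub>} S"
      using a unfolding S.ideal_iff by (simp add: S.l_distr S.m_assoc subset_iff)
    show "finitely_generated_ideal {x \<in> carrier S. x \<otimes>\<^bsub>S\<^esub> a = \<zero>\<^bsub>S\<^esub>} S"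
    proof (rule finitely_generated_retract[OF R.is_cring S p R.annihilator_fg[of "i a"] ann])
      show "p x \<in> {x \<in> carrier S. x \<otimes>\<^bsub>S\<^esub> a = \<zero>\<^bsub>S\<^esub>}"
        if "x \<in> {x \<in> carrier R. x \<otimes>\<^bsub>R\<^esub> i a = \<zero>\<^bsub>R\<^esub>}" for x
      proof -
        have "p (x \<otimes>\<^bsub>R\<^esub> i a) = p x \<otimes>\<^bsub>S\<^esub> p (i a)"
          using that a by (intro p.hom_mult) auto
        then show ?thesis using that a ret[of a] by simp
      qed
      show "i y \<in> {x \<in> carrier R. x \<otimes>\<^bsub>R\<^esub> i a = \<zero>\<^bsub>R\<^esub>}"
        if "y \<in> {x \<in> carrier S. x \<otimes>\<^bsub>S\<^esub> a = \<zero>\<^bsub>S\<^esub>}" for y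
        using that a by (simp flip: i.hom_mult)
    qed (use a ret in auto)
  next
    fix A assume A: "A \<subseteq> carrier S" "finite A" "A \<noteq> {}"
    have iA: "finitely_generated_ideal (\<Inter>a\<in>i ` A. PIdl\<^bsub>R\<^esub> a) R"
      using A by (intro R.Inter_principal_fg) (simp_all add: image_subset_iff subsetD)
    show "finitely_generated_ideal (\<Inter>a\<in>A. PIdl\<^bsub>S\<^esub> a) S"
    proof (rule finitely_generated_retract[OF R.is_cring S p iA S.Inter_PIdl_ideal])
      show "p x \<in> (\<Inter>a\<in>A. PIdl\<^bsub>S\<^esub> a)" if x: "x \<in> (\<Inter>a\<in>i ` A. PIdl\<^bsub>R\<^esub> a)" for x
      proof
        fix a assume "a \<in> A"
        with x obtain r where r: "r \<in> carrier R" "x = r \<otimes>\<^bsub>R\<^esub> i a"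
          by (auto simp: cgenideal_def)
        have "a \<in> carrier S" using A \<open>a \<in> A\<close> by blast
        with r have "p r \<in> carrier S" "p x = p r \<otimes>\<^bsub>S\<^esub> a" using ret by simp_all
        then show "p x \<in> PIdl\<^bsub>S\<^esub> a" by (auto simp: cgenideal_def)
      qed
      show "i y \<in> (\<Inter>a\<in>i ` A. PIdl\<^bsub>R\<^esub> a)" if y: "y \<in> (\<Inter>a\<in>A. PIdl\<^bsub>S\<^esub> a)" for y
      proof clarify
        fix a assume "a \<in> A"
        with y obtain r where r: "r \<in> carrier S" "y = r \<otimes>\<^bsub>S\<^esub> a"
          by (auto simp: cgenideal_def)
        have "a \<in> carrier S" using A \<open>a \<in> A\<close> by blast
        with r have "i r \<in> carrier R" "i y = i r \<otimes>\<^bsub>R\<^esub> i a" by simp_all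
        then show "i y \<in> PIdl\<^bsub>R\<^esub> (i a)" by (auto simp: cgenideal_def)
      qed
    qed (use A ret in auto)
  qed
qed

section \<open>Fractional ideals of a quasi-coherent domain\<close>

lemma zero_in_range_to_fract [simp]: "0 \<in> range to_fract"
  by (rule range_eqI[of _ _ 0]) simp

lemma range_to_fract_mult:
  assumes "x \<in> range to_fract"
  shows "to_fract r * x \<in> range to_fract"
  using assms by (auto simp flip: to_fract_mult)

lemma common_denominator:
  fixes V :: "'a::idom fract set"
  assumes "finite V"
  shows "\<exists>t. t \<noteq> 0 \<and> (\<forall>v\<in>V. to_fract t * v \<in> range to_fract)"
  using assms
proof induction
  case empty
  show ?case by (auto intro: exI[of _ 1])
next
  case (insert v V)
  then obtain t where t: "t \<noteq> 0" "\<forall>v\<in>V. to_fract t * v \<in> range to_fract" by blast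
  obtain a b where v: "v = Fract a b" "b \<noteq> 0" by (cases v) auto
  have "to_fract b * v = to_fract a"
    using v by (simp add: to_fract_def mult_fract eq_fract)
  then have "to_fract b * v \<in> range to_fract" by simp
  then have "to_fract t * (to_fract b * v) \<in> range to_fract"
    by (rule range_to_fract_mult)
  moreover have "to_fract b * (to_fract t * w) \<in> range to_fract" if "w \<in> V" for w
    using t(2) that by (auto intro: range_to_fract_mult)
  ultimately have "\<forall>w\<in>insert v V. to_fract (b * t) * w \<in> range to_fract"
    by (simp add: mult_ac)
  then show ?case using t(1) v(2) by (intro exI[of _ "b * t"]) simp
qed

text \<open>The \<open>D\<close>-submodules of the fraction field. They serve as test objects for
  generation of fractional ideals, as arbitrary ideals do in
  \<open>finitely_generated_ideal_iff\<close>.\<close>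

definition fract_submodule :: "'a::idom fract set \<Rightarrow> bool"
  where "fract_submodule N \<longleftrightarrow> 0 \<in> N \<and> (\<forall>x\<in>N. \<forall>y\<in>N. x + y \<in> N)
    \<and> (\<forall>r. \<forall>x\<in>N. to_fract r * x \<in> N)"

text \<open>\<open>M\<close> is the intersection of the fractional ideals generated by
  \<open>inverse v\<close> for nonzero \<open>v\<close> in \<open>V\<close>. Clearing denominators
  makes it a finite intersection of principal ideals of \<open>D\<close>.\<close>

lemma conductor_finitely_generated:
  fixes V :: "'a::idom fract set"
  assumes qc: "quasi_coherent_ring (ring_of_type_algebra :: 'a ring)"
    and V: "finite V" "\<exists>v\<in>V. v \<noteq> 0"
  defines "M \<equiv> {c. \<forall>v\<in>V. c * v \<in> range to_fract}"
  shows "\<exists>C\<subseteq>M. finite C \<and> (\<forall>N. fract_submodule N \<longrightarrow> C \<subseteq> N \<longrightarrow> M \<subseteq> N)"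
proof -
  let ?D = "ring_of_type_algebra :: 'a ring"
  interpret D: quasi_coherent_ring ?D by fact
  \<comment> \<open>The value \<open>0\<close> imposes no condition on \<open>c\<close> and cannot
    be inverted.\<close>
  define W where "W = V - {0}"
  obtain t where t: "t \<noteq> 0" "\<forall>v\<in>inverse ` W. to_fract t * v \<in> range to_fract"
    using common_denominator[of "inverse ` W"] V(1) by (auto simp: W_def)
  have "\<exists>m. \<forall>v\<in>W. to_fract t * inverse v = to_fract (m v)"
    using t(2) by (intro bchoice) auto
  then obtain m where m: "\<And>v. v \<in> W \<Longrightarrow> to_fract t * inverse v = to_fract (m v)" by blast
  have t0: "to_fract t \<noteq> 0" using t(1) by simp
  define I where "I = (\<Inter>a\<in>m ` W. PIdl\<^bsub>?D\<^esub> a)"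
  \<comment> \<open>With \<open>m v\<close> standing for \<open>t / v\<close>, the condition that
    \<open>(x / t) * v\<close> lies in \<open>D\<close> says that \<open>x\<close> is a multiple of
    \<open>m v\<close> in \<open>D\<close>.\<close>
  have M_iff: "x / to_fract t \<in> M \<longleftrightarrow> (\<forall>v\<in>W. \<exists>r. x = to_fract (r * m v))" for x
  proof -
    have "x / to_fract t * v \<in> range to_fract \<longleftrightarrow> (\<exists>r. x = to_fract (r * m v))"
      if v: "v \<in> W" for v
    proof -
      have "v \<noteq> 0" using v by (simp add: W_def)
      then have "x / to_fract t * v = to_fract r \<longleftrightarrow> x = to_fract r * (to_fract t * inverse v)" for r
        using t0 by (auto simp: field_simps)
      then show ?thesis using m[OF v] by auto
    qed
    moreover have "x / to_fract t \<in> M \<longleftrightarrow> (\<forall>v\<in>W. x / to_fract t * v \<in> range to_fract)"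
      by (auto simp: M_def W_def)
    ultimately show ?thesis by simp
  qed
  have W: "finite W" "W \<noteq> {}" using V by (auto simp: W_def)
  have I_iff: "x \<in> I \<longleftrightarrow> to_fract x / to_fract t \<in> M" for x
    unfolding M_iff by (auto simp: I_def cgenideal_def ring_of_type_algebra_def
        simp del: to_fract_mult)
  have M_to_I: "\<exists>x\<in>I. c = to_fract x / to_fract t" if "c \<in> M" for c
  proof -
    have c: "c = (c * to_fract t) / to_fract t" using t0 by simp
    with that have "\<forall>v\<in>W. \<exists>r. c * to_fract t = to_fract (r * m v)"
      using M_iff[of "c * to_fract t"] by simp
    \<comment> \<open>A single \<open>v\<close> in \<open>W\<close> already forces
      \<open>c * to_fract t\<close> into \<open>D\<close>.\<close>
    with W(2) obtain x where "c * to_fract t = to_fract x" by blast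
    then have cx: "c = to_fract x / to_fract t" using c by simp
    then have "x \<in> I" using that I_iff by simp
    with cx show ?thesis by blast
  qed
  have "finitely_generated_ideal I ?D"
    unfolding I_def using W by (intro D.Inter_principal_fg) (auto simp: ring_of_type_algebra_def)
  then obtain A where A: "finite A" "A \<subseteq> I"
      "\<And>J. ideal J ?D \<Longrightarrow> A \<subseteq> J \<Longrightarrow> I \<subseteq> J"
    by (auto simp: D.finitely_generated_ideal_iff)
  show ?thesis
  proof (intro exI[of _ "(\<lambda>x. to_fract x / to_fract t) ` A"] conjI allI impI)
    show "(\<lambda>x. to_fract x / to_fract t) ` A \<subseteq> M" using A(2) I_iff by blast
    show "finite ((\<lambda>x. to_fract x / to_fract t) ` A)" using A(1) by blast
    fix N :: "'a fract set"
    assume N: "fract_submodule N" "(\<lambda>x. to_fract x / to_fract t) ` A \<subseteq> N"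
    \<comment> \<open>The submodule \<open>N\<close> is pulled back along division by
      \<open>t\<close> to an ideal of \<open>D\<close>, where the generators \<open>A\<close> of
      \<open>I\<close> can be used.\<close>
    have "to_fract (x + y) / to_fract t \<in> N"
      if "to_fract x / to_fract t \<in> N" "to_fract y / to_fract t \<in> N" for x y
      using N(1) that by (simp add: fract_submodule_def add_divide_distrib)
    moreover have "to_fract (r * x) / to_fract t \<in> N" if "to_fract x / to_fract t \<in> N" for r x
      using N(1) that by (simp add: fract_submodule_def flip: times_divide_eq_right)
    moreover have "0 \<in> N" using N(1) by (simp add: fract_submodule_def)
    ultimately have "ideal {x. to_fract x / to_fract t \<in> N} ?D"
      unfolding D.ideal_iff by (simp add: ring_of_type_algebra_def)
    then have "I \<subseteq> {x. to_fract x / to_fract t \<in> N}" using N(2) by (intro A(3)) auto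
    with M_to_I show "M \<subseteq> N" by blast
  qed
qed

section \<open>Polynomials over a field\<close>

lemma lagrange_basis_poly:
  fixes x :: "'k::field"
  assumes "finite S"
  shows "\<exists>l. poly l x = 1 \<and> (\<forall>y\<in>S - {x}. poly l y = 0)"
proof -
  define w where "w = (\<Prod>y\<in>S - {x}. [:- y, 1:])"
  have "poly w x \<noteq> 0" "\<forall>y\<in>S - {x}. poly w y = 0"
    using assms by (auto simp: w_def poly_prod)
  then show ?thesis by (intro exI[of _ "smult (inverse (poly w x)) w"]) auto
qed

text \<open>A nonzero common multiple of least degree works: the remainder of any common multiple
  modulo it is again a common multiple, of smaller degree unless it vanishes.\<close>

lemma least_common_multiple_poly:
  fixes F :: "'k::field poly set"
  assumes "finite F" "0 \<notin> F"
  obtains L where "L \<noteq> 0" "\<And>h. (\<forall>f\<in>F. f dvd h) \<longleftrightarrow> L dvd h"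
proof -
  define P where "P h \<longleftrightarrow> h \<noteq> 0 \<and> (\<forall>f\<in>F. f dvd h)" for h
  have "P (\<Prod>F)" using assms dvd_prodI[of F _ "\<lambda>f. f"] by (simp add: P_def)
  then obtain L where L: "P L" "\<And>h. P h \<Longrightarrow> degree L \<le> degree h"
    using ex_has_least_nat[of P _ degree] by blast
  show ?thesis
  proof (rule that)
    show "L \<noteq> 0" using L(1) by (simp add: P_def)
    fix h
    show "(\<forall>f\<in>F. f dvd h) \<longleftrightarrow> L dvd h"
    proof
      assume h: "\<forall>f\<in>F. f dvd h"
      have "f dvd h mod L" if "f \<in> F" for f
        using h L(1) that by (simp add: P_def dvd_mod)
      then have "h mod L = 0 \<or> degree L \<le> degree (h mod L)"
        using L(2) by (auto simp: P_def)
      then show "L dvd h"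
        using degree_mod_less[of L h] L(1) by (auto simp: P_def mod_eq_0_iff_dvd)
    next
      assume "L dvd h"
      then show "\<forall>f\<in>F. f dvd h" using L(1) by (auto simp: P_def intro: dvd_trans)
    qed
  qed
qed

text \<open>If \<open>x\<close> were a root of all cofactors, cancelling the factor
  \<open>[:- x, 1:]\<close> from \<open>L\<close> would leave a common multiple of smaller
  degree.\<close>

lemma cofactors_no_common_root:
  fixes L :: "'k::field poly"
  assumes L: "L \<noteq> 0" "\<And>h. (\<forall>f\<in>F. f dvd h) \<Longrightarrow> L dvd h"
    and u: "\<And>f. f \<in> F \<Longrightarrow> L = u f * f" and F: "F \<noteq> {}"
  shows "\<exists>f\<in>F. poly (u f) x \<noteq> 0"
proof (rule ccontr)
  assume "\<not> ?thesis"
  then have root: "\<forall>f\<in>F. [:- x, 1:] dvd u f" by (simp add: poly_eq_0_iff_dvd)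
  obtain f where "f \<in> F" using F by blast
  then have "[:- x, 1:] dvd L" using root u[of f] by (simp only: dvd_mult2)
  then obtain q where L_eq: "L = [:- x, 1:] * q" by (rule dvdE)
  have "f dvd q" if "f \<in> F" for f
  proof -
    have "[:- x, 1:] dvd u f" using root that by blast
    then obtain s where s: "u f = [:- x, 1:] * s" by (rule dvdE)
    have "[:- x, 1:] * q = [:- x, 1:] * (s * f)"
      using u[OF that] unfolding L_eq s by (simp only: mult.assoc)
    then have "q = s * f" unfolding mult_cancel_left by simp
    then show ?thesis by simp
  qed
  then have "L dvd q" using L(2) by blast
  moreover have "q \<noteq> 0" using L(1) L_eq by auto
  ultimately have "degree L \<le> degree q" by (rule dvd_imp_degree_le)
  moreover have "degree L = Suc (degree q)"
    unfolding L_eq using \<open>q \<noteq> 0\<close> by (subst degree_mult_eq) simp_all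
  ultimately show False by simp
qed

section \<open>Rings of integer-valued polynomials\<close>

lemma int_valued_ring_simps [simp]:
  "carrier (int_valued_ring E) = int_valued_polys E"
  "x \<otimes>\<^bsub>int_valued_ring E\<^esub> y = x * y"
  "x \<oplus>\<^bsub>int_valued_ring E\<^esub> y = x + y"
  "\<zero>\<^bsub>int_valued_ring E\<^esub> = 0"
  "\<one>\<^bsub>int_valued_ring E\<^esub> = 1"
  by (simp_all add: int_valued_ring_def ring_of_type_algebra_def)

lemma int_valued_polys_iff:
  "g \<in> int_valued_polys E \<longleftrightarrow> (\<forall>e\<in>E. poly g (to_fract e) \<in> range to_fract)"
  by (auto simp: int_valued_polys_def)

lemma Inter_PIdl_int_valued_fg:
  fixes E :: "'a::idom set"
  assumes qc: "quasi_coherent_ring (ring_of_type_algebra :: 'a ring)" and E: "finite E"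
    and F: "F \<subseteq> int_valued_polys E" "finite F" "F \<noteq> {}" "0 \<notin> F"
  shows "finitely_generated_ideal (\<Inter>f\<in>F. PIdl\<^bsub>int_valued_ring E\<^esub> f) (int_valued_ring E)"
proof -
  let ?R = "int_valued_ring E"
  interpret R: cring ?R by (rule cring_int_valued_ring)
  obtain L where L: "L \<noteq> 0" "\<And>h. (\<forall>f\<in>F. f dvd h) \<longleftrightarrow> L dvd h"
    using least_common_multiple_poly[OF F(2,4)] by blast
  have "\<forall>f\<in>F. \<exists>u. L = u * f" using L(2)[of L] by (auto simp: dvd_def mult.commute)
  then obtain u where u: "\<And>f. f \<in> F \<Longrightarrow> L = u f * f" by metis
  \<comment> \<open>\<open>V e\<close> collects the values of the cofactors at \<open>e\<close>;
    \<open>M e\<close> then consists of the values at \<open>e\<close> allowed for \<open>g\<close>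
    when \<open>L * g\<close> lies in the intersection.\<close>
  define V where "V e = (\<lambda>f. poly (u f) (to_fract e)) ` F" for e
  define M where "M e = {c. \<forall>v\<in>V e. c * v \<in> range to_fract}" for e
  have finV: "finite (V e)" for e using F(2) by (simp add: V_def)
  have "\<exists>v\<in>V e. v \<noteq> 0" for e
    using cofactors_no_common_root[of L F u "to_fract e"] L u F(3) by (auto simp: V_def)
  then have "\<forall>e. \<exists>C\<subseteq>M e. finite C \<and> (\<forall>N. fract_submodule N \<longrightarrow> C \<subseteq> N \<longrightarrow> M e \<subseteq> N)"
    unfolding M_def using conductor_finitely_generated[OF qc finV] by blast
  then obtain C where C: "\<And>e. C e \<subseteq> M e" "\<And>e. finite (C e)"
      "\<And>e N. fract_submodule N \<Longrightarrow> C e \<subseteq> N \<Longrightarrow> M e \<subseteq> N"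
    by metis
  obtain d where d: "d \<noteq> 0" "\<forall>v\<in>(\<Union>e\<in>E. V e). to_fract d * v \<in> range to_fract"
    using common_denominator[of "\<Union>e\<in>E. V e"] E finV by auto
  have dM: "to_fract d \<in> M e" if "e \<in> E" for e using d(2) that by (auto simp: M_def)
  have "\<forall>e. \<exists>l. poly l (to_fract e) = 1 \<and> (\<forall>y\<in>to_fract ` E - {to_fract e}. poly l y = 0)"
    using E by (intro allI lagrange_basis_poly) auto
  then obtain l where "\<forall>e. poly (l e) (to_fract e) = 1 \<and>
      (\<forall>y\<in>to_fract ` E - {to_fract e}. poly (l e) y = 0)"
    unfolding choice_iff by blast
  then have l: "\<And>e. poly (l e) (to_fract e) = 1"
      "\<And>e y. y \<in> E \<Longrightarrow> y \<noteq> e \<Longrightarrow> poly (l e) (to_fract y) = 0"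
    by auto
  define J where "J = (\<Inter>f\<in>F. PIdl\<^bsub>?R\<^esub> f)"
  have PIdl_iff: "h \<in> PIdl\<^bsub>?R\<^esub> f \<longleftrightarrow> (\<exists>r\<in>int_valued_polys E. h = r * f)" for h f
    by (auto simp: cgenideal_def)
  have J_iff: "L * g \<in> J \<longleftrightarrow> (\<forall>e\<in>E. poly g (to_fract e) \<in> M e)" for g
  proof -
    \<comment> \<open>Since \<open>L * g = (g * u f) * f\<close> and \<open>f\<close> is
      cancellable, the multiplier of \<open>f\<close> can only be \<open>g * u f\<close>.\<close>
    have "L * g \<in> PIdl\<^bsub>?R\<^esub> f \<longleftrightarrow> g * u f \<in> int_valued_polys E" if "f \<in> F" for f
    proof -
      have "f \<noteq> 0" using that F(4) by blast
      moreover have "L * g = (g * u f) * f" by (subst u[OF that]) (simp add: mult_ac)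
      ultimately show ?thesis by (simp only: PIdl_iff mult_cancel_right) auto
    qed
    then show ?thesis
      by (auto simp: J_def int_valued_polys_iff M_def V_def)
  qed
  have J_dvd: "\<exists>g. h = L * g" if "h \<in> J" for h
    using that L(2)[of h] by (auto simp: J_def PIdl_iff dvd_def mult.commute)
  define S where "S = insert (L * [:to_fract d:]) (\<Union>e\<in>E. (\<lambda>c. L * smult c (l e)) ` C e)"
  have "finite S" using E C(2) by (auto simp: S_def)
  moreover have "S \<subseteq> J"
  proof -
    have "L * smult c (l e) \<in> J" if "c \<in> C e" for e c
    proof -
      have "poly (smult c (l e)) (to_fract y) \<in> M y" if "y \<in> E" for y
        using C(1)[of e] \<open>c \<in> C e\<close> that l by (cases "y = e") (auto simp: M_def)
      then show ?thesis by (simp only: J_iff) blast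
    qed
    moreover have "L * [:to_fract d:] \<in> J" unfolding J_iff using dM by simp
    ultimately show ?thesis by (auto simp: S_def)
  qed
  moreover have "J \<subseteq> I" if I: "ideal I ?R" "S \<subseteq> I" for I
  proof
    have I_add: "a + b \<in> I" if "a \<in> I" "b \<in> I" for a b
      using I(1) that by (auto simp: R.ideal_iff)
    have I_mult: "r * a \<in> I" if "a \<in> I" "r \<in> int_valued_polys E" for a r
      using I(1) that by (auto simp: R.ideal_iff)
    have I_zero: "0 \<in> I" using I(1) by (auto simp: R.ideal_iff)
    have lag: "L * smult c (l e) \<in> I" if "e \<in> E" "c \<in> M e" for e c
    proof -
      \<comment> \<open>Constants from \<open>D\<close> are integer-valued, so the good coefficients
        form a \<open>D\<close>-submodule; containing \<open>C e\<close>, it contains all of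
        \<open>M e\<close>.\<close>
      have "fract_submodule {c. L * smult c (l e) \<in> I}"
        unfolding fract_submodule_def
      proof (intro conjI ballI allI CollectI)
        show "L * smult 0 (l e) \<in> I" using I_zero by simp
        show "L * smult (x + y) (l e) \<in> I"
          if "x \<in> {c. L * smult c (l e) \<in> I}" "y \<in> {c. L * smult c (l e) \<in> I}" for x y
          using I_add that by (simp add: smult_add_left distrib_left)
        show "L * smult (to_fract r * x) (l e) \<in> I"
          if "x \<in> {c. L * smult c (l e) \<in> I}" for r x
          using I_mult[of "L * smult x (l e)" "[:to_fract r:]"] that
          by (simp add: int_valued_polys_iff mult.commute)
      qed
      moreover have "C e \<subseteq> {c. L * smult c (l e) \<in> I}"
        using I(2) that(1) by (auto simp: S_def)
      ultimately show ?thesis using C(3) that(2) by blast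
    qed
    fix h assume "h \<in> J"
    then obtain g where h: "h = L * g" using J_dvd by blast
    then have g: "\<And>e. e \<in> E \<Longrightarrow> poly g (to_fract e) \<in> M e" using J_iff \<open>h \<in> J\<close> by blast
    \<comment> \<open>\<open>s\<close> is the Lagrange interpolant of \<open>g\<close> on
      \<open>E\<close>.\<close>
    define s where "s = (\<Sum>e\<in>E. smult (poly g (to_fract e)) (l e))"
    have Ls: "L * s = (\<Sum>e\<in>E. L * smult (poly g (to_fract e)) (l e))"
      by (simp add: s_def sum_distrib_left)
    \<comment> \<open>The induction runs over subsets of \<open>E\<close>, so that every summand
      still belongs to a point of \<open>E\<close>.\<close>
    have "(\<Sum>e\<in>E'. L * smult (poly g (to_fract e)) (l e)) \<in> I" if "E' \<subseteq> E" for E'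
      using finite_subset[OF that E] that
      by (induction E' rule: finite_induct)
        (auto intro: I_zero I_add lag g simp del: mult_smult_right)
    then have sI: "L * s \<in> I" unfolding Ls by blast
    have s_eval: "poly s (to_fract y) = poly g (to_fract y)" if "y \<in> E" for y
    proof -
      have "poly s (to_fract y) = (\<Sum>e\<in>E. if e = y then poly g (to_fract y) else 0)"
        unfolding s_def poly_sum using that l by (intro sum.cong) auto
      then show ?thesis using E that by simp
    qed
    \<comment> \<open>\<open>g - s\<close> vanishes on \<open>E\<close>, so dividing it by
      \<open>d\<close> keeps it integer-valued there; the generator
      \<open>L * [:to_fract d:]\<close> absorbs this remaining part of \<open>h\<close>.\<close>
    define r where "r = smult (inverse (to_fract d)) (g - s)"
    have "r \<in> int_valued_polys E" using s_eval by (simp add: r_def int_valued_polys_iff)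
    moreover have "L * [:to_fract d:] \<in> I" using I(2) by (simp add: S_def)
    ultimately have "r * (L * [:to_fract d:]) \<in> I" by (rule I_mult[rotated])
    moreover have "h = L * s + r * (L * [:to_fract d:])"
      using d(1) by (simp add: h r_def algebra_simps)
    ultimately show "h \<in> I" using I_add sI by simp
  qed
  moreover have "ideal J ?R"
    unfolding J_def using F by (intro R.Inter_PIdl_ideal) auto
  ultimately show ?thesis
    unfolding R.finitely_generated_ideal_iff J_def[symmetric] by blast
qed

theorem corollary6p10:
  fixes E :: "'a::idom set"
  assumes "finite E" and "E \<noteq> {}"
  shows "quasi_coherent_ring (int_valued_ring E) \<longleftrightarrow>
    quasi_coherent_ring (ring_of_type_algebra :: 'a ring)"
proof
  let ?R = "int_valued_ring E" and ?D = "ring_of_type_algebra :: 'a ring"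
  assume qc: "quasi_coherent_ring ?R"
  obtain e where e: "e \<in> E" using assms(2) by blast
  \<comment> \<open>Evaluation at \<open>e\<close>, read as an element of \<open>D\<close>; it is
    meaningful on \<open>int_valued_polys E\<close>, where the value lies in the range of
    \<open>to_fract\<close>.\<close>
  define p where "p g = the_inv to_fract (poly g (to_fract e))" for g :: "'a fract poly"
  have p_eq: "p g = x" if "poly g (to_fract e) = to_fract x" for g x
    unfolding p_def that by (rule the_inv_f_f) (simp add: inj_def)
  have val: "poly g (to_fract e) = to_fract (p g)" if g: "g \<in> int_valued_polys E" for g
  proof -
    obtain x where "poly g (to_fract e) = to_fract x"
      using g e by (auto simp: int_valued_polys_iff)
    then show ?thesis using p_eq by simp
  qed
  show "quasi_coherent_ring ?D"
  proof (rule quasi_coherent_retract[OF qc cring_from_type_algebra])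
    show "p \<in> ring_hom ?R ?D"
      by (auto simp: ring_hom_def ring_of_type_algebra_def val intro!: p_eq)
    show "(\<lambda>x. [:to_fract x:]) \<in> ring_hom ?D ?R"
      by (auto simp: ring_hom_def ring_of_type_algebra_def int_valued_polys_iff)
    show "p [:to_fract x:] = x" for x by (simp add: p_eq)
  qed
next
  let ?R = "int_valued_ring E" and ?D = "ring_of_type_algebra :: 'a ring"
  interpret R: cring ?R by (rule cring_int_valued_ring)
  assume qc: "quasi_coherent_ring ?D"
  show "quasi_coherent_ring ?R"
  proof unfold_locales
    fix a assume "a \<in> carrier ?R"
    \<comment> \<open>The ring sits inside a polynomial ring over a field, so it has no zero
      divisors.\<close>
    have "{x \<in> carrier ?R. x \<otimes>\<^bsub>?R\<^esub> a = \<zero>\<^bsub>?R\<^esub>} = (if a = 0 then carrier ?R else {\<zero>\<^bsub>?R\<^esub>})"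
      using R.zero_closed by auto
    then show "finitely_generated_ideal {x \<in> carrier ?R. x \<otimes>\<^bsub>?R\<^esub> a = \<zero>\<^bsub>?R\<^esub>} ?R"
      using R.finitely_generated_zero R.finitely_generated_carrier by (simp del: int_valued_ring_simps)
  next
    fix F assume F: "F \<subseteq> carrier ?R" "finite F" "F \<noteq> {}"
    show "finitely_generated_ideal (\<Inter>f\<in>F. PIdl\<^bsub>?R\<^esub> f) ?R"
    proof (cases "0 \<in> F")
      \<comment> \<open>A zero generator collapses the intersection to the zero ideal; in the other
        case the least common multiple is nonzero.\<close>
      case True
      then have "(\<Inter>f\<in>F. PIdl\<^bsub>?R\<^esub> f) \<subseteq> PIdl\<^bsub>?R\<^esub> 0" by blast
      also have "\<dots> = {0}" using R.zero_closed by (auto simp: cgenideal_def)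
      finally have "(\<Inter>f\<in>F. PIdl\<^bsub>?R\<^esub> f) \<subseteq> {0}" .
      moreover have "0 \<in> (\<Inter>f\<in>F. PIdl\<^bsub>?R\<^esub> f)"
        using R.Inter_PIdl_ideal[OF F(1,3)] by (simp add: R.ideal_iff)
      ultimately have "(\<Inter>f\<in>F. PIdl\<^bsub>?R\<^esub> f) = {\<zero>\<^bsub>?R\<^esub>}" by auto
      then show ?thesis using R.finitely_generated_zero by simp
    next
      case False
      then show ?thesis using Inter_PIdl_int_valued_fg[OF qc assms(1)] F by simp
    qed
  qed
qed

end
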